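(* Let $p$ be a fixed prime and let $\Lambda(\mathbf{x})\in\mathbb{Z}_p[x_1^{\pm1},\dots,x_d^{\pm1}]$ be a Laurent polynomial whose Newton polyhedron contains the origin as its only interior integral point. Define $A(n)$, for $n\in\mathbb{N}$, as the constant term of $\Lambda(\mathbf{x})^n$. Assume that the generating function $f_A(z)=\sum_{n\ge0}A(n)z^n$ is annihilated by a differential operator $\mathcal{L}\in\mathbb{Z}_p[z,\theta]$ such that at least one of the following holds: (i) $\mathcal{L}$ is of type I; (ii) $\mathcal{L}$ is of type II and $p-1\in\mathcal{Z}_p(A)$. Then for all $n\in\mathbb{N}$, $A(n)\in p^{\alpha_p(A,n)}\mathbb{Z}_p$.
   Context: $\mathbb{Z}_p$ is the ring of $p$-adic integers. For a $\mathbb{Z}_p$-valued sequence $A$, $\mathcal{Z}_p(A)$ is the set of $v\in\{0,\dots,p-1\}$ with $A(v)\in p\mathbb{Z}_p$, and for $n\in\mathbb{N}$ with base-$p$ expansion $n=\sum_{k=0}^N n_kp^k$ ($n_k\in\{0,\dots,p-1\}$, $n_N\ne0$; for $n=0$ the single digit $0$), $\alpha_p(A,n)$ is the number of $k$ with $n_k\in\mathcal{Z}_p(A)$. $\theta=z\frac{d}{dz}$. An operator $\mathcal{L}=\sum_{k=0}^q z^kP_k(\theta)$ with $P_k\in\mathbb{Z}_p[X]$ is of type I if $P_0(\mathbb{Z}_p^\times)\subset\mathbb{Z}_p^\times$ and $P_k(X)\in\prod_{i=1}^{k-1}(X+i)^2\,\mathbb{Z}_p[X]$ for all $k\in\{2,\dots,q\}$;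 it is of type II if $q=2$, $P_0(\mathbb{Z}_p^\times)\subset\mathbb{Z}_p^\times$ and $P_2(X)\in(X+1)\mathbb{Z}_p[X]$. *)

theory Defs
  imports
    "HOL-Analysis.Analysis"
    "HOL-Library.Poly_Mapping"
    "Berlekamp_Zassenhaus.Finite_Field"
begin

section \<open>The ring of \<open>p\<close>-adic integers\<close>

text \<open>
  The prime is \<open>p = CARD('p)\<close> for a type \<open>'p\<close> of prime cardinality.
  The ring of \<open>p\<close>-adic integers is the inverse limit of the rings of integers modulo \<open>p ^ n\<close>:
  an element is a sequence of residues compatible with reduction. The single equation below also
  says that the \<open>n\<close>-th entry is the canonical representative, i.e. lies in \<open>{0..<p ^ n}\<close>.
\<close>

typedef (overloaded) ('p :: prime_card) padic_int =
  "{f :: nat \<Rightarrow> int. \<forall>n. f n = f (Suc n) mod int CARD('p) ^ n}"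
  by (intro exI[of _ "\<lambda>_. 0"]) simp

setup_lifting type_definition_padic_int

lemma mod_power_Suc_mod: "a mod (q :: int) ^ Suc n mod q ^ n = a mod q ^ n"
  by (rule mod_mod_cancel) simp

lemma compatible_residues:
  fixes a b a' b' q :: int
  assumes "a = a' mod q ^ n" and "b = b' mod q ^ n"
  shows "(a + b) mod q ^ n = (a' + b') mod q ^ Suc n mod q ^ n"
    and "(a - b) mod q ^ n = (a' - b') mod q ^ Suc n mod q ^ n"
    and "(a * b) mod q ^ n = (a' * b') mod q ^ Suc n mod q ^ n"
  unfolding mod_power_Suc_mod assms by (simp_all add: mod_simps)

lemma compatible_residue_uminus:
  fixes a a' q :: int
  assumes "a = a' mod q ^ n"
  shows "(- a) mod q ^ n = (- a') mod q ^ Suc n mod q ^ n"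
  unfolding mod_power_Suc_mod assms by (simp add: mod_simps)

instantiation padic_int :: (prime_card) comm_ring_1
begin

lift_definition zero_padic_int :: "'a padic_int" is "\<lambda>_. 0"
  by simp

lift_definition one_padic_int :: "'a padic_int" is "\<lambda>n. 1 mod int CARD('a) ^ n"
  by (simp only: mod_power_Suc_mod simp_thms)

lift_definition plus_padic_int :: "'a padic_int \<Rightarrow> 'a padic_int \<Rightarrow> 'a padic_int"
  is "\<lambda>f g n. (f n + g n) mod int CARD('a) ^ n"
  by (intro allI compatible_residues) blast+

lift_definition minus_padic_int :: "'a padic_int \<Rightarrow> 'a padic_int \<Rightarrow> 'a padic_int"
  is "\<lambda>f g n. (f n - g n) mod int CARD('a) ^ n"
  by (intro allI compatible_residues) blast+

lift_definition uminus_padic_int :: "'a padic_int \<Rightarrow> 'a padic_int"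
  is "\<lambda>f n. (- f n) mod int CARD('a) ^ n"
  by (intro allI compatible_residue_uminus) blast+

lift_definition times_padic_int :: "'a padic_int \<Rightarrow> 'a padic_int \<Rightarrow> 'a padic_int"
  is "\<lambda>f g n. (f n * g n) mod int CARD('a) ^ n"
  by (intro allI compatible_residues) blast+

instance
proof
  note rep_eqs = zero_padic_int.rep_eq one_padic_int.rep_eq plus_padic_int.rep_eq
    minus_padic_int.rep_eq uminus_padic_int.rep_eq times_padic_int.rep_eq
  have rep_mod [simp]: "Rep_padic_int x n mod int CARD('a) ^ n = Rep_padic_int x n"
    for x :: "'a padic_int" and n
  proof -
    have "Rep_padic_int x n = Rep_padic_int x (Suc n) mod int CARD('a) ^ n"
      using Rep_padic_int[of x] by blast
    then show ?thesis
      by (metis mod_mod_trivial)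
  qed
  have eqI: "x = y" if "\<And>n. Rep_padic_int x n = Rep_padic_int y n" for x y :: "'a padic_int"
    using that by (auto simp flip: Rep_padic_int_inject)
  fix a b c :: "'a padic_int"
  show "a * b * c = a * (b * c)"
    by (rule eqI) (simp add: rep_eqs mod_simps mult.assoc)
  show "a * b = b * a"
    by (rule eqI) (simp add: rep_eqs mult.commute)
  show "1 * a = a"
    by (rule eqI) (simp add: rep_eqs mod_simps)
  show "a + b + c = a + (b + c)"
    by (rule eqI) (simp add: rep_eqs mod_simps add.assoc)
  show "a + b = b + a"
    by (rule eqI) (simp add: rep_eqs add.commute)
  show "0 + a = a"
    by (rule eqI) (simp add: rep_eqs)
  show "- a + a = 0"
    by (rule eqI) (simp add: rep_eqs mod_simps)
  show "a - b = a + - b"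
    by (rule eqI) (simp add: rep_eqs mod_simps)
  show "(a + b) * c = a * c + b * c"
    by (rule eqI) (simp add: rep_eqs mod_simps distrib_right)
  have "1 < int CARD('a)"
    using prime_gt_1_nat[OF prime_card[where 'a = 'a]] by linarith
  then have "Rep_padic_int (0 :: 'a padic_int) 1 \<noteq> Rep_padic_int 1 1"
    by (simp add: rep_eqs)
  then show "(0 :: 'a padic_int) \<noteq> 1"
    by metis
qed

end

section \<open>Laurent polynomials\<close>

text \<open>
  Finitely supported functions on the exponent lattice, with the convolution product of
  \<^theory>\<open>HOL-Library.Poly_Mapping\<close>, form the ring of Laurent polynomials in the
  \<open>CARD('d)\<close> variables indexed by \<open>'d\<close>.
\<close>

type_synonym ('d, 'a) laurent_poly = "(int ^ 'd) \<Rightarrow>\<^sub>0 'a"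

definition lattice_point :: "int ^ 'd \<Rightarrow> real ^ 'd" where
  "lattice_point m = (\<chi> i. real_of_int (m $ i))"

definition newton_polyhedron :: "('d :: finite, 'a :: zero) laurent_poly \<Rightarrow> (real ^ 'd) set" where
  "newton_polyhedron \<Lambda> = convex hull (lattice_point ` Poly_Mapping.keys \<Lambda>)"

definition constant_term_seq :: "('d :: finite, 'a :: comm_semiring_1) laurent_poly \<Rightarrow> nat \<Rightarrow> 'a" where
  "constant_term_seq \<Lambda> n = Poly_Mapping.lookup (\<Lambda> ^ n) 0"

section \<open>Digits\<close>

definition zero_digits :: "(nat \<Rightarrow> 'p :: prime_card padic_int) \<Rightarrow> nat set" where
  "zero_digits A = {v. v < CARD('p) \<and> of_nat CARD('p) dvd A v}"

text \<open>
  The digit positions of \<open>n\<close> are the \<open>k\<close> with \<open>p ^ k \<le> n\<close>, and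
  the position \<open>0\<close> alone if \<open>n = 0\<close>; leading zeros are not counted.
\<close>

definition digit_positions :: "nat \<Rightarrow> nat \<Rightarrow> nat set" where
  "digit_positions p n = {k. k = 0 \<or> p ^ k \<le> n}"

definition zero_digit_count :: "(nat \<Rightarrow> 'p :: prime_card padic_int) \<Rightarrow> nat \<Rightarrow> nat" where
  "zero_digit_count A n =
     card {k \<in> digit_positions CARD('p) n. n div CARD('p) ^ k mod CARD('p) \<in> zero_digits A}"

section \<open>Differential operators\<close>

text \<open>\<^const>\<open>fps_XD\<close> is the derivation \<open>\<theta> = z d/dz\<close>.\<close>

definition theta_poly :: "'a :: comm_ring_1 poly \<Rightarrow> 'a fps \<Rightarrow> 'a fps" where
  "theta_poly P f = (\<Sum>i\<le>degree P. fps_const (poly.coeff P i) * (fps_XD ^^ i) f)"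

definition diff_op :: "nat \<Rightarrow> (nat \<Rightarrow> 'a :: comm_ring_1 poly) \<Rightarrow> 'a fps \<Rightarrow> 'a fps" where
  "diff_op q P f = (\<Sum>k\<le>q. fps_X ^ k * theta_poly (P k) f)"

text \<open>The image of \<open>R[z, \<theta>]\<close> in the endomorphisms of \<open>R[[z]]\<close>; powers of \<open>z\<close> can be moved to the left by \<open>\<theta> z = z (\<theta> + 1)\<close>.\<close>

definition diff_operators :: "('a :: comm_ring_1 fps \<Rightarrow> 'a fps) set" where
  "diff_operators = {diff_op q P | q P. True}"

definition preserves_units :: "'a :: comm_ring_1 poly \<Rightarrow> bool" where
  "preserves_units P \<longleftrightarrow> (\<forall>u. u dvd 1 \<longrightarrow> poly P u dvd 1)"

definition type_I :: "('p :: prime_card padic_int fps \<Rightarrow> 'p padic_int fps) \<Rightarrow> bool" where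
  "type_I L \<longleftrightarrow> (\<exists>q P. L = diff_op q P \<and> preserves_units (P 0) \<and>
     (\<forall>k\<in>{2..q}. (\<Prod>i=1..k - 1. [:of_nat i, 1:]\<^sup>2) dvd P k))"

definition type_II :: "('p :: prime_card padic_int fps \<Rightarrow> 'p padic_int fps) \<Rightarrow> bool" where
  "type_II L \<longleftrightarrow> (\<exists>P. L = diff_op 2 P \<and> preserves_units (P 0) \<and> [:1, 1:] dvd P 2)"

end

theory Submission
  imports Defs
begin

text \<open>
  Write \<open>\<alpha>(n)\<close> for the number of zero digits of \<open>n\<close>; since \<open>A(0) = 1\<close>, appending a
  digit \<open>v\<close> to \<open>m\<close> increases \<open>\<alpha>\<close> by one exactly if \<open>v\<close> is a zero digit, also for \<open>m = 0\<close>,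
  and \<open>\<alpha>(m + b) \<le> \<alpha>(m) + b\<close>. By strong induction on \<open>n\<close>, the constant term of
  \<open>G \<Lambda>^(n - k)\<close> is divisible by \<open>p^(\<alpha>(n) - k)\<close> whenever \<open>G\<close> is supported in \<open>t \<Delta>\<close> with \<open>t < k + 1\<close>,
  \<open>\<Delta>\<close> being the Newton polyhedron.

  Let \<open>n = v + m p\<close> with \<open>v < p\<close>. If \<open>k > 0\<close> or \<open>v = 0\<close>, expand the powers of
  \<open>\<Lambda>(x)^p = \<Lambda>(x^p) + p R(x)\<close> and apply the Cartier operator, which divides supports by \<open>p\<close>
  and turns \<open>\<Lambda>(x^p)\<close> into \<open>\<Lambda>(x)\<close>: this reduces the claim to the induction hypothesis for \<open>m\<close>.
  If \<open>k = 0\<close>, then \<open>G\<close> is a constant because the origin is the only interior lattice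
  point. For \<open>v > 0\<close> the recurrence given by the differential operator then yields
  \<open>A(v + m p) \<equiv> A(v) A(m p)\<close> modulo \<open>p^(\<alpha>(m) + 1)\<close>: the terms which reach back below \<open>m p\<close> by
  \<open>b\<close> blocks of length \<open>p\<close> lose at most \<open>b\<close> in \<open>\<alpha>\<close>, but gain \<open>2 b\<close> from the squares in type I;
  in type II one borrow gains \<open>1\<close> from the factor \<open>X + 1\<close> and \<open>1\<close> from the zero digit \<open>p - 1\<close>.
\<close>

section \<open>Congruences modulo a prime\<close>

text \<open>The inner binomial coefficients are divisible by \<open>p\<close>. The ring is arbitrary
  because the congruence serves both the \<open>p\<close>-adic integers and the Laurent
  polynomials.\<close>

lemma prime_dvd_add_power_diff:
  fixes a b :: "'a :: comm_ring_1"
  assumes "prime p"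
  shows "of_nat p dvd (a + b) ^ p - (a ^ p + b ^ p)"
proof -
  have p: "p > 0"
    using assms prime_gt_0_nat by blast
  have split: "{..p} = insert 0 (insert p {0<..<p})"
    using p by auto
  have "(a + b) ^ p = b ^ p + a ^ p + (\<Sum>k\<in>{0<..<p}. of_nat (p choose k) * a ^ k * b ^ (p - k))"
    using p by (simp add: binomial_ring split)
  moreover have "of_nat p dvd (\<Sum>k\<in>{0<..<p}. of_nat (p choose k) * a ^ k * b ^ (p - k))"
  proof (intro dvd_sum dvd_mult2)
    fix k assume "k \<in> {0<..<p}"
    then have "p dvd p choose k"
      using assms by (intro dvd_choose_prime) auto
    then show "of_nat p dvd (of_nat (p choose k) :: 'a)"
      by (metis dvd_def of_nat_mult)
  qed
  ultimately show ?thesis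
    by simp
qed

lemma prime_dvd_sum_power_diff:
  fixes f :: "'b \<Rightarrow> 'a :: comm_ring_1"
  assumes "prime p"
  shows "of_nat p dvd (\<Sum>x\<in>S. f x) ^ p - (\<Sum>x\<in>S. f x ^ p)"
proof (induction S rule: infinite_finite_induct)
  case (insert x S)
  have "(f x + sum f S) ^ p - (f x ^ p + (\<Sum>x\<in>S. f x ^ p))
      = ((f x + sum f S) ^ p - (f x ^ p + sum f S ^ p)) + (sum f S ^ p - (\<Sum>x\<in>S. f x ^ p))"
    by simp
  also have "of_nat p dvd \<dots>"
    by (intro dvd_add prime_dvd_add_power_diff insert assms)
  finally show ?case
    using insert.hyps by simp
qed (use prime_gt_0_nat[OF assms] in \<open>simp_all add: power_0_left\<close>)

text \<open>With \<open>x - y\<close> divisible by \<open>p\<close>, this makes the coefficients of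
  the recurrence \<open>p\<close>-periodic modulo \<open>p\<close>.\<close>

lemma dvd_poly_diff: "x - y dvd poly Q x - poly Q (y :: 'a :: comm_ring_1)"
proof (induction Q)
  case (pCons a Q)
  have "poly (pCons a Q) x - poly (pCons a Q) y = (x - y) * poly Q x + y * (poly Q x - poly Q y)"
    by (simp add: algebra_simps)
  then show ?case
    using pCons by (metis dvd_add dvd_mult dvd_triv_left)
qed simp

section \<open>Arithmetic of \<open>p\<close>-adic integers\<close>

lemmas padic_rep_eqs = zero_padic_int.rep_eq one_padic_int.rep_eq plus_padic_int.rep_eq
  minus_padic_int.rep_eq uminus_padic_int.rep_eq times_padic_int.rep_eq

lemma Rep_padic_int_Suc_mod:
  fixes x :: "'p :: prime_card padic_int"
  shows "Rep_padic_int x (Suc n) mod int CARD('p) ^ n = Rep_padic_int x n"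
proof -
  have "Rep_padic_int x n = Rep_padic_int x (Suc n) mod int CARD('p) ^ n"
    using Rep_padic_int[of x] by blast
  then show ?thesis
    by (rule sym)
qed

lemma Rep_padic_int_mod:
  fixes x :: "'p :: prime_card padic_int"
  shows "Rep_padic_int x n mod int CARD('p) ^ n = Rep_padic_int x n"
  by (metis Rep_padic_int_Suc_mod mod_mod_trivial)

lemma Rep_padic_int_mod_p:
  fixes x :: "'p :: prime_card padic_int"
  shows "Rep_padic_int x (Suc n) mod int CARD('p) = Rep_padic_int x 1"
proof (induction n)
  case 0
  then show ?case using Rep_padic_int_mod[of x 1] by simp
next
  case (Suc n)
  have "Rep_padic_int x (Suc (Suc n)) mod int CARD('p) ^ Suc n mod int CARD('p) = Rep_padic_int x 1"
    unfolding Rep_padic_int_Suc_mod by (rule Suc)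
  then show ?case
    by (subst (asm) mod_mod_cancel) simp_all
qed

lemma Rep_padic_int_of_nat:
  "Rep_padic_int (of_nat m :: 'p :: prime_card padic_int) n = int m mod int CARD('p) ^ n"
  by (induction m) (simp_all add: padic_rep_eqs mod_simps)

text \<open>The quotient is read off one level higher: its residue modulo \<open>p ^ n\<close> is
  the residue of \<open>x\<close> modulo \<open>p ^ (n + 1)\<close>, divided by
  \<open>p\<close>.\<close>

lemma padic_int_p_dvd_iff:
  fixes x :: "'p :: prime_card padic_int"
  shows "of_nat CARD('p) dvd x \<longleftrightarrow> Rep_padic_int x 1 = 0"
proof
  assume "of_nat CARD('p) dvd x"
  then show "Rep_padic_int x 1 = 0"
    by (auto simp: padic_rep_eqs Rep_padic_int_of_nat)
next
  let ?q = "int CARD('p)"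
  assume x: "Rep_padic_int x 1 = 0"
  have dvd: "?q dvd Rep_padic_int x (Suc n)" for n
    using Rep_padic_int_mod_p[of x n] x by auto
  define y :: "'p padic_int" where "y = Abs_padic_int (\<lambda>n. Rep_padic_int x (Suc n) div ?q)"
  have y: "Rep_padic_int y n = Rep_padic_int x (Suc n) div ?q" for n
    unfolding y_def
  proof (subst Abs_padic_int_inverse, safe)
    fix n
    have "Rep_padic_int x (Suc n) div ?q
        = (Rep_padic_int x (Suc (Suc n)) mod (?q * ?q ^ n)) div ?q"
      using Rep_padic_int_Suc_mod[of x "Suc n"] by simp
    also have "\<dots> = Rep_padic_int x (Suc (Suc n)) div ?q mod ?q ^ n"
      by (simp add: zmod_zmult2_eq)
    finally show "Rep_padic_int x (Suc n) div ?q
        = Rep_padic_int x (Suc (Suc n)) div ?q mod ?q ^ n" .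
  qed
  have "Rep_padic_int x n = Rep_padic_int (of_nat CARD('p) * y) n" for n
    using dvd[of n] Rep_padic_int_Suc_mod[of x n]
    by (simp add: padic_rep_eqs Rep_padic_int_of_nat y mod_simps)
  then show "of_nat CARD('p) dvd x"
    by (metis Rep_padic_int_inject dvd_triv_left ext)
qed

text \<open>Level \<open>n + 1\<close> of \<open>p x\<close> determines level \<open>n\<close> of
  \<open>x\<close>.\<close>

lemma padic_int_p_mult_eq_0:
  fixes x :: "'p :: prime_card padic_int"
  assumes "of_nat CARD('p) * x = 0"
  shows "x = 0"
proof -
  have "Rep_padic_int x n = 0" for n
  proof -
    have "(int CARD('p) * Rep_padic_int x (Suc n)) mod int CARD('p) ^ Suc n = 0"
      using arg_cong[OF assms, of "\<lambda>y. Rep_padic_int y (Suc n)"]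
      by (simp add: padic_rep_eqs Rep_padic_int_of_nat mod_mult_left_eq del: power_Suc)
    then have "int CARD('p) ^ n dvd Rep_padic_int x (Suc n)"
      by (simp add: mod_eq_0_iff_dvd)
    then show ?thesis
      using Rep_padic_int_Suc_mod[of x n] by simp
  qed
  then show ?thesis
    by (metis Rep_padic_int_inject ext zero_padic_int.rep_eq)
qed

text \<open>Inverses of \<open>n\<close> modulo the powers of \<open>p\<close> are compatible, since
  \<open>n\<close> can be cancelled in congruences modulo \<open>p ^ k\<close>.\<close>

lemma padic_int_of_nat_dvd_1:
  assumes "\<not> CARD('p) dvd n"
  shows "(of_nat n :: 'p :: prime_card padic_int) dvd 1"
proof -
  let ?q = "int CARD('p)"
  have cop: "coprime (int n) (?q ^ k)" for k
    using assms prime_imp_coprime[OF prime_card[where 'a = 'p]]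
    by (metis coprime_commute coprime_int_iff coprime_power_right_iff)
  have "\<exists>y. [int n * y = 1] (mod ?q ^ k)" for k
    using cong_solve_coprime_int[OF cop] by auto
  then obtain g where g: "\<And>k. [int n * g k = 1] (mod ?q ^ k)"
    by metis
  define y :: "'p padic_int" where "y = Abs_padic_int (\<lambda>k. g k mod ?q ^ k)"
  have y: "Rep_padic_int y k = g k mod ?q ^ k" for k
    unfolding y_def
  proof (subst Abs_padic_int_inverse, safe)
    fix k
    have "[int n * g (Suc k) = 1] (mod ?q ^ k)"
      by (rule cong_dvd_modulus[OF g]) simp
    then have "[int n * g k = int n * g (Suc k)] (mod ?q ^ k)"
      using g cong_sym cong_trans by blast
    then have "[g k = g (Suc k)] (mod ?q ^ k)"
      using cong_mult_lcancel[OF cop] by blast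
    then show "g k mod ?q ^ k = g (Suc k) mod ?q ^ Suc k mod ?q ^ k"
      by (simp only: mod_power_Suc_mod cong_def)
  qed
  have "Rep_padic_int (of_nat n * y) k = Rep_padic_int (1 :: 'p padic_int) k" for k
    using g[of k] by (simp add: padic_rep_eqs Rep_padic_int_of_nat y mod_simps cong_def)
  then have "of_nat n * y = 1"
    by (metis Rep_padic_int_inject ext)
  then show ?thesis
    by (metis dvd_triv_left)
qed

text \<open>Natural numbers are handled by induction, and every \<open>x\<close> is congruent modulo
  \<open>p\<close> to a natural number, its residue at level 1.\<close>

lemma padic_int_fermat:
  fixes x :: "'p :: prime_card padic_int"
  shows "of_nat CARD('p) dvd x ^ CARD('p) - x"
proof -
  let ?p = "CARD('p)"
  note prime = prime_card[where 'a = 'p]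
  have nat: "of_nat ?p dvd (of_nat m :: 'p padic_int) ^ ?p - of_nat m" for m
  proof (induction m)
    case (Suc m)
    have "(of_nat (Suc m) :: 'p padic_int) ^ ?p - of_nat (Suc m)
        = (of_nat m + 1) ^ ?p - (of_nat m ^ ?p + 1 ^ ?p) + (of_nat m ^ ?p - of_nat m)"
      by (simp add: add.commute)
    with Suc show ?case
      using prime_dvd_add_power_diff[OF prime] by (metis dvd_add)
  qed (use prime_gt_0_nat[OF prime] in \<open>simp add: power_0_left\<close>)
  define m where "m = nat (Rep_padic_int x 1)"
  have m: "int m = Rep_padic_int x 1"
    using Rep_padic_int_mod[of x 1] unfolding m_def
    using pos_mod_sign[of "int CARD('p) ^ 1" "Rep_padic_int x 1"] by simp
  have dvd: "of_nat ?p dvd x - of_nat m"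
    unfolding padic_int_p_dvd_iff
    by (simp add: padic_rep_eqs Rep_padic_int_of_nat mod_simps m del: One_nat_def)
  moreover have "x - of_nat m dvd x ^ ?p - of_nat m ^ ?p"
    by (simp add: power_diff_sumr2)
  ultimately have "of_nat ?p dvd x ^ ?p - of_nat m ^ ?p"
    by (rule dvd_trans)
  from dvd_diff[OF dvd_add[OF this nat[of m]] dvd] show ?thesis
    by simp
qed

section \<open>The Cartier operator\<close>

text \<open>For \<open>a = 0\<close> this is multiplication by a scalar, encoded as
  \<open>single 0 c\<close>.\<close>

lemma lookup_mult_single:
  fixes f :: "('d :: ab_group_add, 'a :: comm_semiring_1) poly_mapping"
  shows "Poly_Mapping.lookup (f * Poly_Mapping.single a c) k = Poly_Mapping.lookup f (k - a) * c"
proof -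
  have "(\<Sum>q. Poly_Mapping.lookup (Poly_Mapping.single a c) q when k = l + q) = (c when l = k - a)" for l
  proof -
    have "(\<Sum>q. Poly_Mapping.lookup (Poly_Mapping.single a c) q when k = l + q)
        = (\<Sum>q. (c when k = l + a) when q = a)"
      by (intro Sum_any.cong) (auto simp: lookup_single when_def)
    then show ?thesis
      by (auto simp: when_def algebra_simps)
  qed
  then have "Poly_Mapping.lookup (f * Poly_Mapping.single a c) k
      = (\<Sum>l. Poly_Mapping.lookup f l * c when l = k - a)"
    by (simp add: lookup_mult mult_when)
  then show ?thesis
    by simp
qed

lemma sum_single_lookup:
  "(\<Sum>a\<in>Poly_Mapping.keys f. Poly_Mapping.single a (Poly_Mapping.lookup f a)) = f"
  by (rule poly_mapping_eqI) (auto simp: lookup_sum lookup_single when_def in_keys_iff)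

definition cartier :: "nat \<Rightarrow> ('d :: finite, 'a :: comm_ring_1) laurent_poly \<Rightarrow> ('d, 'a) laurent_poly" where
  "cartier p = Poly_Mapping.map_key (\<lambda>m. int p *s m)"

text \<open>The substitution of \<open>x^p\<close> for \<open>x\<close>. Coefficients stay
  unchanged, so the comparison with \<open>f ^ p\<close> modulo \<open>p\<close> rests on Fermat's
  congruence.\<close>

definition frob :: "nat \<Rightarrow> ('d :: finite, 'a :: comm_ring_1) laurent_poly \<Rightarrow> ('d, 'a) laurent_poly" where
  "frob p f = (\<Sum>a\<in>Poly_Mapping.keys f. Poly_Mapping.single (int p *s a) (Poly_Mapping.lookup f a))"

lemma lookup_cartier:
  assumes "p > 0"
  shows "Poly_Mapping.lookup (cartier p f) m = Poly_Mapping.lookup f (int p *s m)"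
proof -
  have "inj (\<lambda>m :: int ^ 'd. int p *s m)"
    using assms by (auto intro!: injI simp: vec_eq_iff)
  then show ?thesis
    by (simp add: cartier_def map_key.rep_eq[OF \<open>inj _\<close>])
qed

text \<open>The projection formula: multiplying by \<open>frob p g\<close> shifts exponents by
  multiples \<open>p a\<close>, and \<open>p m - p a = p (m - a)\<close>.\<close>

lemma cartier_mult_frob:
  assumes "p > 0"
  shows "cartier p (f * frob p g) = cartier p f * g"
proof (rule poly_mapping_eqI)
  fix m
  have "Poly_Mapping.lookup (cartier p (f * frob p g)) m
      = (\<Sum>a\<in>Poly_Mapping.keys g. Poly_Mapping.lookup (cartier p f) (m - a) * Poly_Mapping.lookup g a)"
    unfolding lookup_cartier[OF assms] frob_def sum_distrib_left lookup_sum lookup_mult_single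
      vector_ssub_ldistrib ..
  also have "\<dots> = Poly_Mapping.lookup
      (\<Sum>a\<in>Poly_Mapping.keys g. cartier p f * Poly_Mapping.single a (Poly_Mapping.lookup g a)) m"
    unfolding lookup_sum lookup_mult_single ..
  also have "\<dots> = Poly_Mapping.lookup (cartier p f * g) m"
    by (simp add: sum_distrib_left[symmetric] sum_single_lookup)
  finally show "Poly_Mapping.lookup (cartier p (f * frob p g)) m
      = Poly_Mapping.lookup (cartier p f * g) m" .
qed

lemma cartier_mult_frob_power:
  assumes "p > 0"
  shows "cartier p (f * frob p g ^ n) = cartier p f * g ^ n"
proof (induction n)
  case (Suc n)
  then show ?case
    using cartier_mult_frob[OF assms, of "f * frob p g ^ n" g] by (simp add: ac_simps)
qed simp

text \<open>Modulo \<open>p\<close>, the \<open>p\<close>-th power of a sum of monomials is the sum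
  of their \<open>p\<close>-th powers; Fermat's congruence then restores the coefficients.\<close>

lemma dvd_power_diff_frob:
  fixes f :: "('d :: finite, 'p :: prime_card padic_int) laurent_poly"
  shows "of_nat CARD('p) dvd f ^ CARD('p) - frob CARD('p) f"
proof -
  let ?p = "CARD('p)" and ?K = "Poly_Mapping.keys f" and ?c = "Poly_Mapping.lookup f"
  have single_power: "Poly_Mapping.single a c ^ n = Poly_Mapping.single (int n *s a) (c ^ n)"
    for a :: "int ^ 'd" and c :: "'p padic_int" and n
    by (induction n)
      (simp_all add: mult_single vector_sadd_rdistrib flip: single_one)
  have "f ^ ?p - frob ?p f = (\<Sum>a\<in>?K. Poly_Mapping.single a (?c a)) ^ ?p
        - (\<Sum>a\<in>?K. Poly_Mapping.single a (?c a) ^ ?p)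
      + (\<Sum>a\<in>?K. Poly_Mapping.single (int ?p *s a) (?c a ^ ?p - ?c a))"
    by (simp add: sum_single_lookup frob_def single_power single_diff sum_subtractf)
  moreover have "of_nat ?p dvd (\<Sum>a\<in>?K. Poly_Mapping.single (int ?p *s a) (?c a ^ ?p - ?c a))"
  proof (intro dvd_sum)
    fix a
    obtain r where "?c a ^ ?p - ?c a = of_nat ?p * r"
      using padic_int_fermat by (metis dvdE)
    then have "Poly_Mapping.single (int ?p *s a) (?c a ^ ?p - ?c a)
        = of_nat ?p * Poly_Mapping.single (int ?p *s a) r"
      by (simp add: mult_single flip: single_of_nat)
    then show "of_nat ?p dvd Poly_Mapping.single (int ?p *s a) (?c a ^ ?p - ?c a)"
      by simp
  qed
  ultimately show ?thesis
    using prime_dvd_sum_power_diff[OF prime_card[where 'a = 'p],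
        of "\<lambda>a. Poly_Mapping.single a (?c a)" ?K] by simp
qed

section \<open>Supports\<close>

text \<open>The scale \<open>t\<close> is real because the Cartier operator divides it by
  \<open>p\<close>.\<close>

definition supported :: "(real ^ 'd) set \<Rightarrow> real \<Rightarrow> ('d :: finite, 'a :: zero) laurent_poly \<Rightarrow> bool" where
  "supported K t f \<longleftrightarrow> (\<forall>m\<in>Poly_Mapping.keys f. lattice_point m \<in> (*\<^sub>R) t ` K)"

lemma lattice_point_0 [simp]: "lattice_point 0 = 0"
  by (simp add: lattice_point_def vec_eq_iff)

lemma lattice_point_add: "lattice_point (a + b) = lattice_point a + lattice_point b"
  by (simp add: lattice_point_def vec_eq_iff)

lemma lattice_point_scale: "lattice_point (int n *s a) = real n *\<^sub>R lattice_point a"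
  by (simp add: lattice_point_def vec_eq_iff)

text \<open>The convex weights are \<open>s / (s + t)\<close> and \<open>t / (s + t)\<close>, whence
  the separate case \<open>s + t = 0\<close>.\<close>

lemma convex_scaled_add:
  fixes K :: "'a :: real_vector set"
  assumes "convex K" "0 \<le> s" "0 \<le> t" "x \<in> (*\<^sub>R) s ` K" "y \<in> (*\<^sub>R) t ` K"
  shows "x + y \<in> (*\<^sub>R) (s + t) ` K"
proof -
  obtain u w where u: "u \<in> K" "x = s *\<^sub>R u" and w: "w \<in> K" "y = t *\<^sub>R w"
    using assms by auto
  show ?thesis
  proof (cases "s + t = 0")
    case True
    then have "s = 0" "t = 0"
      using assms by auto
    then show ?thesis
      using u w by auto
  next
    case False
    have "(s / (s + t)) *\<^sub>R u + (t / (s + t)) *\<^sub>R w \<in> K"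
      using assms u w False by (intro convexD) (auto simp flip: add_divide_distrib)
    moreover have "x + y = (s + t) *\<^sub>R ((s / (s + t)) *\<^sub>R u + (t / (s + t)) *\<^sub>R w)"
      using False u w by (simp add: scaleR_add_right)
    ultimately show ?thesis
      by blast
  qed
qed

lemma supported_mult:
  assumes "convex K" "0 \<le> s" "0 \<le> t" "supported K s f" "supported K t g"
  shows "supported K (s + t) (f * g)"
  unfolding supported_def
proof
  fix m
  assume "m \<in> Poly_Mapping.keys (f * g)"
  then obtain a b where "m = a + b" "a \<in> Poly_Mapping.keys f" "b \<in> Poly_Mapping.keys g"
    using keys_mult by blast
  then show "lattice_point m \<in> (*\<^sub>R) (s + t) ` K"
    using assms convex_scaled_add[OF assms(1-3)] by (auto simp: lattice_point_add supported_def)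
qed

lemma supported_one: "0 \<in> K \<Longrightarrow> supported K 0 1"
  by (auto simp: supported_def)

lemma supported_power:
  assumes "convex K" "0 \<in> K" "0 \<le> t" "supported K t f"
  shows "supported K (real n * t) (f ^ n)"
proof (induction n)
  case (Suc n)
  then show ?case
    using supported_mult[OF assms(1,3) _ assms(4) Suc] assms(3) by (simp add: algebra_simps)
qed (use supported_one[OF assms(2)] in simp)

lemma supported_cartier:
  assumes "p > 0" "supported K t f"
  shows "supported K (t / real p) (cartier p f)"
  unfolding supported_def
proof
  fix m
  assume "m \<in> Poly_Mapping.keys (cartier p f)"
  then have "int p *s m \<in> Poly_Mapping.keys f"
    using assms(1) by (simp add: in_keys_iff lookup_cartier)
  then obtain x where x: "x \<in> K" "real p *\<^sub>R lattice_point m = t *\<^sub>R x"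
    using assms(2) by (auto simp: supported_def lattice_point_scale)
  have "lattice_point m = (1 / real p) *\<^sub>R (real p *\<^sub>R lattice_point m)"
    using assms(1) by simp
  also have "\<dots> = (t / real p) *\<^sub>R x"
    by (simp add: x)
  finally show "lattice_point m \<in> (*\<^sub>R) (t / real p) ` K"
    using x by blast
qed

lemma keys_frob: "Poly_Mapping.keys (frob p f) \<subseteq> (\<lambda>a. int p *s a) ` Poly_Mapping.keys f"
proof
  fix m
  assume "m \<in> Poly_Mapping.keys (frob p f)"
  then have "(\<Sum>a\<in>Poly_Mapping.keys f.
      Poly_Mapping.lookup (Poly_Mapping.single (int p *s a) (Poly_Mapping.lookup f a)) m) \<noteq> 0"
    by (simp add: in_keys_iff frob_def lookup_sum)
  then obtain a where a: "a \<in> Poly_Mapping.keys f"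
    "Poly_Mapping.lookup (Poly_Mapping.single (int p *s a) (Poly_Mapping.lookup f a)) m \<noteq> 0"
    by (rule sum.not_neutral_contains_not_neutral)
  then show "m \<in> (\<lambda>a. int p *s a) ` Poly_Mapping.keys f"
    by (auto simp: lookup_single when_def split: if_splits)
qed

lemma supported_frob:
  assumes "supported K 1 f"
  shows "supported K (real p) (frob p f)"
  unfolding supported_def
proof
  fix m
  assume "m \<in> Poly_Mapping.keys (frob p f)"
  then obtain a where a: "a \<in> Poly_Mapping.keys f" "m = int p *s a"
    using keys_frob by blast
  then have "lattice_point a \<in> K"
    using assms by (auto simp: supported_def)
  then show "lattice_point m \<in> (*\<^sub>R) (real p) ` K"
    by (auto simp: a lattice_point_scale)
qed

text \<open>Both \<open>f ^ p\<close> and \<open>frob p f\<close> live on \<open>p K\<close>, hence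
  so does their difference \<open>p R\<close>; \<open>R\<close> has the same support because
  \<open>p\<close> is not a zero divisor.\<close>

lemma frobenius_decomposition:
  fixes f :: "('d :: finite, 'p :: prime_card padic_int) laurent_poly"
  assumes "convex K" "0 \<in> K" "supported K 1 f"
  obtains R where "f ^ CARD('p) = frob CARD('p) f + of_nat CARD('p) * R"
    and "supported K (real CARD('p)) R"
proof -
  let ?p = "CARD('p)"
  obtain R where R: "f ^ ?p - frob ?p f = of_nat ?p * R"
    using dvd_power_diff_frob by (metis dvdE)
  have "supported K (real ?p) R"
    unfolding supported_def
  proof
    fix m
    assume "m \<in> Poly_Mapping.keys R"
    have "Poly_Mapping.lookup (of_nat ?p * R) m = of_nat ?p * Poly_Mapping.lookup R m"
      using lookup_mult_single[of R 0 "of_nat ?p" m] by (simp add: mult.commute)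
    then have "Poly_Mapping.lookup (of_nat ?p * R) m \<noteq> 0"
      using padic_int_p_mult_eq_0 \<open>m \<in> _\<close> by (metis in_keys_iff)
    then have "Poly_Mapping.lookup (f ^ ?p) m \<noteq> 0 \<or> Poly_Mapping.lookup (frob ?p f) m \<noteq> 0"
      unfolding R[symmetric] lookup_minus by auto
    then show "lattice_point m \<in> (*\<^sub>R) (real ?p) ` K"
      using supported_power[OF assms(1,2) _ assms(3), of ?p] supported_frob[OF assms(3), of ?p]
      by (auto simp: supported_def in_keys_iff)
  qed
  moreover have "f ^ ?p = frob ?p f + of_nat ?p * R"
    using R by (simp add: algebra_simps)
  ultimately show ?thesis
    using that by blast
qed

text \<open>Scaling by \<open>t < 1\<close> pulls every point of \<open>K\<close> towards the
  interior point 0 and so into the interior, where 0 is the only lattice point.\<close>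

lemma supported_interior_imp_constant:
  assumes "convex K" "{m. lattice_point m \<in> interior K} = {0}"
    and "0 \<le> t" "t < 1" "supported K t f"
  shows "f = Poly_Mapping.single 0 (Poly_Mapping.lookup f 0)"
proof -
  have int: "0 \<in> interior K"
    using assms(2) lattice_point_0 by (metis mem_Collect_eq singletonI)
  have "m = 0" if m: "m \<in> Poly_Mapping.keys f" for m
  proof -
    obtain x where x: "x \<in> K" "lattice_point m = t *\<^sub>R x"
      using assms m by (auto simp: supported_def)
    have "x - (1 - t) *\<^sub>R (x - 0) \<in> interior K"
      using mem_interior_convex_shrink[OF assms(1) int x(1), of "1 - t"] assms by simp
    then have "lattice_point m \<in> interior K"
      using x by (simp add: algebra_simps)
    then show ?thesis
      using assms(2) by blast
  qed
  then show ?thesis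
    by (intro poly_mapping_eqI) (auto simp: lookup_single when_def in_keys_iff)
qed

section \<open>Digits\<close>

lemma digit_positions_less:
  assumes "v < p"
  shows "digit_positions p v = {0}"
proof -
  have "k = 0" if "p ^ k \<le> v" for k
    using that assms self_le_power[of p k] by (cases "k = 0") auto
  then show ?thesis
    by (auto simp: digit_positions_def)
qed

lemma digit_positions_step:
  assumes "v < p" "m > 0"
  shows "digit_positions p (v + m * p) = insert 0 (Suc ` digit_positions p m)"
proof -
  have "p ^ Suc k \<le> v + m * p \<longleftrightarrow> p ^ k \<le> m" for k
  proof -
    have "p ^ Suc k \<le> v + m * p \<longleftrightarrow> p ^ k \<le> (v + m * p) div p"
      using assms by (subst less_eq_div_iff_mult_less_eq) (auto simp: ac_simps)
    then show ?thesis
      using assms by simp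
  qed
  then have "k \<in> digit_positions p (v + m * p) \<longleftrightarrow> k \<in> insert 0 (Suc ` digit_positions p m)" for k
  proof (cases k)
    case (Suc l)
    have "l \<in> digit_positions p m \<longleftrightarrow> p ^ l \<le> m"
      using assms by (auto simp: digit_positions_def)
    with Suc \<open>\<And>k. p ^ Suc k \<le> v + m * p \<longleftrightarrow> p ^ k \<le> m\<close>[of l] show ?thesis
      by (simp add: digit_positions_def inj_image_mem_iff del: power_Suc)
  qed (simp add: digit_positions_def)
  then show ?thesis
    by blast
qed

lemma finite_digit_positions: "p > 1 \<Longrightarrow> finite (digit_positions p n)"
proof (rule finite_subset[of _ "{..n}"])
  assume "p > 1"
  then show "digit_positions p n \<subseteq> {..n}"
    by (auto simp: digit_positions_def intro: order_trans[OF less_imp_le[OF power_gt_expt]])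
qed simp

text \<open>For \<open>m = 0\<close> the number on the left has the single digit \<open>v\<close>,
  and the digit of \<open>m\<close> counts nothing because \<open>0\<close> is not a zero
  digit.\<close>

lemma zero_digit_count_step:
  fixes A :: "nat \<Rightarrow> 'p :: prime_card padic_int"
  assumes "0 \<notin> zero_digits A" "v < CARD('p)"
  shows "zero_digit_count A (v + m * CARD('p)) = zero_digit_count A m + of_bool (v \<in> zero_digits A)"
proof (cases "m = 0")
  case True
  have "0 < CARD('p)"
    by simp
  from digit_positions_less[OF this] digit_positions_less[OF assms(2)] show ?thesis
    using True assms by (auto simp: zero_digit_count_def Collect_conv_if conj_commute)
next
  case False
  let ?p = "CARD('p)" and ?Z = "zero_digits A"
  let ?D = "\<lambda>n. {k \<in> digit_positions ?p n. n div ?p ^ k mod ?p \<in> ?Z}"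
  have fin: "finite (?D m)"
    using finite_digit_positions prime_gt_1_nat[OF prime_card[where 'a = 'p]] by simp
  have "(v + m * ?p) div ?p ^ Suc k mod ?p = m div ?p ^ k mod ?p" for k
    using assms by (simp add: div_mult2_eq)
  then have "?D (v + m * ?p) = (if v \<in> ?Z then {0} else {}) \<union> Suc ` ?D m"
    unfolding digit_positions_step[OF assms(2) False[unfolded neq0_conv]] using assms(2)
    by (auto simp del: power_Suc)
  moreover have "card (Suc ` ?D m) = card (?D m)"
    by (simp add: card_image)
  ultimately show ?thesis
    using fin by (auto simp: zero_digit_count_def card_insert_if)
qed

text \<open>Without a carry only the last digit changes. With a carry the new last digit is
  \<open>0\<close>, which adds nothing, and induction applies to the leading part
  \<open>m\<close>.\<close>

lemma zero_digit_count_Suc_le: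
  fixes A :: "nat \<Rightarrow> 'p :: prime_card padic_int"
  assumes "0 \<notin> zero_digits A"
  shows "zero_digit_count A (Suc n) \<le> zero_digit_count A n + 1"
proof (induction n rule: less_induct)
  case (less n)
  let ?p = "CARD('p)"
  define v m where "v = n mod ?p" and "m = n div ?p"
  have n: "n = v + m * ?p" and v: "v < ?p"
    by (simp_all add: v_def m_def)
  show ?case
  proof (cases "Suc v < ?p")
    case True
    have "Suc n = Suc v + m * ?p"
      by (simp add: n)
    then show ?thesis
      unfolding n using zero_digit_count_step[OF assms True] zero_digit_count_step[OF assms v]
      by (metis add.assoc add_le_mono le_add1 le_refl of_bool_less_eq_one)
  next
    case False
    then have *: "Suc n = 0 + Suc m * ?p"
      using n v by simp
    have "n \<noteq> 0"
      using False n prime_gt_1_nat[OF prime_card[where 'a = 'p]] by auto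
    then have "m < n"
      using prime_gt_1_nat[OF prime_card[where 'a = 'p]] by (simp add: m_def)
    then have "zero_digit_count A (Suc m) \<le> zero_digit_count A m + 1"
      using less.IH by blast
    then show ?thesis
      unfolding * zero_digit_count_step[OF assms zero_less_card_finite]
      unfolding n zero_digit_count_step[OF assms v] using assms by simp
  qed
qed

lemma zero_digit_count_le_diff:
  fixes A :: "nat \<Rightarrow> 'p :: prime_card padic_int"
  assumes "0 \<notin> zero_digits A"
  shows "zero_digit_count A (n + b) \<le> zero_digit_count A n + b"
  using zero_digit_count_Suc_le[OF assms] by (induction b) (auto intro: order_trans)

section \<open>The two congruences\<close>

text \<open>
  The number \<open>b\<close> counts how many copies of \<open>\<Lambda>^p\<close> are borrowed from \<open>\<Lambda>^(m p)\<close> to make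
  the exponent \<open>v - k\<close> nonnegative.
\<close>

lemma dwork_step:
  fixes \<Lambda> G :: "('d :: finite, 'p :: prime_card padic_int) laurent_poly"
  assumes K: "convex K" "0 \<in> K" and \<Lambda>: "supported K 1 \<Lambda>"
    and G: "supported K t G" "0 \<le> t" "t < real k + 1"
    and v: "v < CARD('p)" and b: "b \<le> m" "k \<le> v + b * CARD('p)"
    and IH: "\<And>H s j. \<lbrakk>j \<le> m; 0 \<le> s; s < real j + 1; supported K s H\<rbrakk>
      \<Longrightarrow> of_nat CARD('p) ^ (a - j) dvd Poly_Mapping.lookup (H * \<Lambda> ^ (m - j)) 0"
  shows "of_nat CARD('p) ^ (a - b) dvd Poly_Mapping.lookup (G * \<Lambda> ^ (v + m * CARD('p) - k)) 0"
proof -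
  let ?p = "CARD('p)"
  have p: "?p > 0"
    by simp
  obtain R where R: "\<Lambda> ^ ?p = frob ?p \<Lambda> + of_nat ?p * R" and supp_R: "supported K (real ?p) R"
    using frobenius_decomposition[OF K \<Lambda>] .
  \<comment> \<open>The exponent left beside the \<open>m - b\<close> factors
    \<open>\<Lambda> ^ p\<close> that are expanded.\<close>
  define e where "e = v + b * ?p - k"
  have "v + m * ?p - k = e + ?p * (m - b)"
    using b mult_le_mono1[OF b(1), of ?p] by (simp add: e_def diff_mult_distrib2 mult.commute)
  then have "G * \<Lambda> ^ (v + m * ?p - k) = G * \<Lambda> ^ e * (of_nat ?p * R + frob ?p \<Lambda>) ^ (m - b)"
    by (simp add: power_add power_mult R ac_simps)
  also have "\<dots> = (\<Sum>j\<le>m - b. of_nat ((m - b) choose j) * of_nat ?p ^ j *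
      (G * \<Lambda> ^ e * R ^ j * frob ?p \<Lambda> ^ (m - b - j)))"
    unfolding binomial_ring sum_distrib_left by (simp add: power_mult_distrib ac_simps)
  also have "\<dots> = (\<Sum>j\<le>m - b. (G * \<Lambda> ^ e * R ^ j * frob ?p \<Lambda> ^ (m - b - j)) *
      Poly_Mapping.single 0 (of_nat ((m - b) choose j) * of_nat ?p ^ j))"
    by (simp add: mult.commute flip: of_nat_power of_nat_mult)
  finally have "Poly_Mapping.lookup (G * \<Lambda> ^ (v + m * ?p - k)) 0 = (\<Sum>j\<le>m - b.
      Poly_Mapping.lookup (G * \<Lambda> ^ e * R ^ j * frob ?p \<Lambda> ^ (m - b - j)) 0 *
      (of_nat ((m - b) choose j) * of_nat ?p ^ j))"
    by (simp only: lookup_sum lookup_mult_single diff_zero)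
  moreover have "of_nat ?p ^ (a - b) dvd
      Poly_Mapping.lookup (G * \<Lambda> ^ e * R ^ j * frob ?p \<Lambda> ^ (m - b - j)) 0 *
      (of_nat ((m - b) choose j) * of_nat ?p ^ j)" if j: "j \<le> m - b" for j
  proof -
    let ?H = "cartier ?p (G * \<Lambda> ^ e * R ^ j)"
    let ?s = "(t + real e + real j * real ?p) / real ?p"
    have "Poly_Mapping.lookup (G * \<Lambda> ^ e * R ^ j * frob ?p \<Lambda> ^ (m - b - j)) 0
        = Poly_Mapping.lookup (cartier ?p (G * \<Lambda> ^ e * R ^ j * frob ?p \<Lambda> ^ (m - b - j))) 0"
      by (simp add: lookup_cartier)
    also have "\<dots> = Poly_Mapping.lookup (?H * \<Lambda> ^ (m - (b + j))) 0"
      by (simp add: cartier_mult_frob_power)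
    finally have eq: "Poly_Mapping.lookup (G * \<Lambda> ^ e * R ^ j * frob ?p \<Lambda> ^ (m - b - j)) 0
        = Poly_Mapping.lookup (?H * \<Lambda> ^ (m - (b + j))) 0" .
    have "supported K ?s ?H"
      using supported_power[OF K _ \<Lambda>, of e] supported_power[OF K _ supp_R, of j] G
      by (intro supported_cartier supported_mult K) simp_all
    \<comment> \<open>From \<open>t < k + 1\<close> and \<open>e = v + b p - k\<close> follows
      \<open>t + e + j p < v + 1 + (b + j) p\<close>, and \<open>v + 1 \<le> p\<close> by
      integrality.\<close>
    moreover have "?s < real (b + j) + 1"
    proof -
      have "real e = real v + real b * real ?p - real k"
        using b by (simp add: e_def of_nat_diff)
      moreover have "real v + 1 \<le> real ?p"
        using v by linarith
      ultimately have "t + real e + real j * real ?p < (real (b + j) + 1) * real ?p"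
        using G by (simp add: algebra_simps)
      then show ?thesis
        by (simp add: divide_less_eq)
    qed
    moreover have "0 \<le> ?s"
      using G by simp
    ultimately have "of_nat ?p ^ (a - (b + j)) dvd Poly_Mapping.lookup (?H * \<Lambda> ^ (m - (b + j))) 0"
      using j b by (intro IH) auto
    \<comment> \<open>The \<open>j\<close> powers lost in the induction hypothesis come back from
      \<open>p ^ j\<close> in the binomial expansion.\<close>
    then have "of_nat ?p ^ (a - (b + j) + j) dvd
        Poly_Mapping.lookup (?H * \<Lambda> ^ (m - (b + j))) 0 * (of_nat ((m - b) choose j) * of_nat ?p ^ j)"
      unfolding power_add by (intro mult_dvd_mono dvd_mult) auto
    then show ?thesis
      unfolding eq by (rule power_le_dvd) simp
  qed
  ultimately show ?thesis
    by (auto intro: dvd_sum)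
qed

section \<open>The recurrence given by a differential operator\<close>

lemma fps_nth_theta_poly: "fps_nth (theta_poly Q f) n = poly Q (of_nat n) * fps_nth f n"
  by (simp add: theta_poly_def fps_sum_nth fps_mult_fps_XD_shift poly_altdef sum_distrib_right mult.assoc)

lemma fps_nth_diff_op:
  "fps_nth (diff_op q Q f) n = (\<Sum>k\<le>min q n. poly (Q k) (of_nat (n - k)) * fps_nth f (n - k))"
proof -
  have "fps_nth (diff_op q Q f) n =
      (\<Sum>k\<le>q. if n < k then 0 else poly (Q k) (of_nat (n - k)) * fps_nth f (n - k))"
    by (simp add: diff_op_def fps_sum_nth fps_X_power_mult_nth fps_nth_theta_poly cong: if_cong)
  also have "\<dots> = (\<Sum>k\<in>{..min q n}. poly (Q k) (of_nat (n - k)) * fps_nth f (n - k))"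
    by (rule sum.mono_neutral_cong_right) auto
  finally show ?thesis .
qed

text \<open>
  A recurrence whose terms crossing the block boundary \<open>m p\<close> are negligible has, up to a common
  factor, the same solution on each block, because its coefficients are \<open>p\<close>-periodic modulo \<open>p\<close>.
\<close>

lemma recurrence_congruence:
  fixes A :: "nat \<Rightarrow> 'p :: prime_card padic_int"
  assumes rec: "\<And>n. (\<Sum>k\<le>min q n. poly (Q k) (of_nat (n - k)) * A (n - k)) = 0"
    and A0: "A 0 = 1" and units: "preserves_units (Q 0)"
    and dvd: "of_nat CARD('p) ^ a dvd A (m * CARD('p))"
    and cross: "\<And>v k. \<lbrakk>1 \<le> v; v < CARD('p); v < k; k \<le> q; k \<le> v + m * CARD('p)\<rbrakk> \<Longrightarrow>
      of_nat CARD('p) ^ (a + 1) dvd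
        poly (Q k) (of_nat (v + m * CARD('p) - k)) * A (v + m * CARD('p) - k)"
    and "v < CARD('p)"
  shows "of_nat CARD('p) ^ (a + 1) dvd A (v + m * CARD('p)) - A v * A (m * CARD('p))"
  using \<open>v < CARD('p)\<close>
proof (induction v rule: less_induct)
  case (less v)
  let ?p = "CARD('p)"
  let ?P = "of_nat ?p :: 'p padic_int"
  define M where "M = m * ?p"
  define T where "T n k = poly (Q k) (of_nat (n - k)) * A (n - k)" for n k
  \<comment> \<open>The recurrences at \<open>v + M\<close> and at \<open>v\<close> both sum to 0,
    so the \<open>E k\<close> with \<open>k \<le> min q v\<close> add up to minus the terms at
    \<open>v + M\<close> that cross the boundary.\<close>
  define E where "E k = T (v + M) k - A M * T v k" for k
  show ?case
  proof (cases "v = 0")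
    case False
    \<comment> \<open>The first summand is a multiple of the difference in the claim at
      \<open>v - k\<close>; the second gains \<open>p\<close> from periodicity and
      \<open>p ^ a\<close> from \<open>A M\<close>.\<close>
    have split: "E k = poly (Q k) (of_nat (v - k + M)) * (A (v - k + M) - A (v - k) * A M)
        + (poly (Q k) (of_nat (v - k + M)) - poly (Q k) (of_nat (v - k))) * A M * A (v - k)"
      if "k \<le> v" for k
      using that by (simp add: E_def T_def algebra_simps)
    have p_dvd: "?P dvd poly (Q k) (of_nat (w + M)) - poly (Q k) (of_nat w)" for k w
    proof (rule dvd_trans[OF _ dvd_poly_diff])
      show "?P dvd of_nat (w + M) - of_nat w"
        by (simp add: M_def)
    qed
    have rest: "?P ^ (a + 1) dvd
        (poly (Q k) (of_nat (w + M)) - poly (Q k) (of_nat w)) * A M * A w" for k w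
      using mult_dvd_mono[OF p_dvd dvd] by (simp add: M_def dvd_mult2)
    have "(\<Sum>k\<le>min q (v + M). T (v + M) k)
        = (\<Sum>k\<le>min q v. T (v + M) k) + (\<Sum>k\<in>{v<..min q (v + M)}. T (v + M) k)"
      by (subst sum.union_disjoint[symmetric]) (auto intro!: sum.cong)
    then have "(\<Sum>k\<le>min q v. E k) = - (\<Sum>k\<in>{v<..min q (v + M)}. T (v + M) k)"
      using rec[of "v + M"] rec[of v]
      by (simp add: E_def T_def sum_subtractf eq_neg_iff_add_eq_0 flip: sum_distrib_left)
    also have "?P ^ (a + 1) dvd \<dots>"
      using cross[of v] less.prems False
      by (auto simp: T_def M_def intro!: dvd_sum)
    also have "{..min q v} = insert 0 {1..min q v}"
      by auto
    finally have "?P ^ (a + 1) dvd E 0 + (\<Sum>k\<in>{1..min q v}. E k)"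
      by simp
    moreover have "?P ^ (a + 1) dvd (\<Sum>k\<in>{1..min q v}. E k)"
    proof (intro dvd_sum)
      fix k
      assume k: "k \<in> {1..min q v}"
      then have "?P ^ (a + 1) dvd A (v - k + M) - A (v - k) * A M"
        unfolding M_def using less.prems by (intro less.IH) auto
      moreover have "k \<le> v"
        using k by simp
      ultimately show "?P ^ (a + 1) dvd E k"
        unfolding split[OF \<open>k \<le> v\<close>] by (intro dvd_add[OF _ rest] dvd_mult)
    qed
    ultimately have "?P ^ (a + 1) dvd E 0"
      by (simp only: dvd_add_left_iff)
    then have "?P ^ (a + 1) dvd poly (Q 0) (of_nat (v + M)) * (A (v + M) - A v * A M)"
      using rest[of 0 v] split[of 0] by (simp only: dvd_add_left_iff diff_zero le0)
    \<comment> \<open>As \<open>0 < v < p\<close>, the number \<open>v + M\<close> is a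
      \<open>p\<close>-adic unit, so the leading coefficient can be divided out.\<close>
    moreover have "\<not> ?p dvd v + M"
      using False less.prems by (auto simp: M_def dvd_add_left_iff dest: dvd_imp_le)
    then have "poly (Q 0) (of_nat (v + M)) dvd 1"
      using units padic_int_of_nat_dvd_1 by (auto simp: preserves_units_def simp del: of_nat_add)
    then obtain u where u: "poly (Q 0) (of_nat (v + M)) * u = 1"
      by (metis dvdE)
    ultimately have "?P ^ (a + 1) dvd u * (poly (Q 0) (of_nat (v + M)) * (A (v + M) - A v * A M))"
      by (simp only: dvd_mult)
    also have "\<dots> = poly (Q 0) (of_nat (v + M)) * u * (A (v + M) - A v * A M)"
      by (simp only: ac_simps)
    finally show ?thesis
      by (simp only: M_def[symmetric] u mult_1)
  qed (simp add: A0)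
qed

section \<open>Terms that cross a block boundary\<close>

text \<open>The \<open>b\<close> distinct multiples \<open>(m' + 1) p, ..., (m' + b) p\<close> all
  occur among the factors \<open>n + 1, ..., n + k - 1\<close>.\<close>

lemma prime_power_dvd_prod_interval:
  fixes p :: nat
  assumes "p > 0" "n < Suc m' * p" "(m' + b) * p < n + k"
  shows "p ^ b dvd (\<Prod>i = 1..k - 1. n + i)"
proof -
  let ?f = "\<lambda>j. (m' + j) * p - n"
  have le: "n < (m' + j) * p" if "j \<in> {1..b}" for j
    using that assms(2) mult_le_mono1[of "Suc m'" "m' + j" p] by simp
  have ub: "(m' + j) * p < n + k" if "j \<in> {1..b}" for j
    using that le_less_trans[OF mult_le_mono1 assms(3), of "m' + j"] by simp
  have inj: "inj_on ?f {1..b}"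
  proof (rule inj_onI)
    fix i j
    assume "i \<in> {1..b}" "j \<in> {1..b}" "?f i = ?f j"
    then have "(m' + i) * p = (m' + j) * p"
      using le[of i] le[of j] by linarith
    then show "i = j"
      using assms(1) by simp
  qed
  have "p ^ b = (\<Prod>j\<in>{1..b}. p)"
    by simp
  also have "\<dots> dvd (\<Prod>j\<in>{1..b}. n + ?f j)"
  proof (rule prod_dvd_prod)
    fix j
    assume "j \<in> {1..b}"
    then have "n + ?f j = (m' + j) * p"
      using le[of j] by simp
    then show "p dvd n + ?f j"
      by simp
  qed
  also have "\<dots> = (\<Prod>i\<in>?f ` {1..b}. n + i)"
    unfolding prod.reindex[OF inj] o_def ..
  also have "\<dots> dvd (\<Prod>i = 1..k - 1. n + i)"
  proof (rule prod_dvd_prod_subset)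
    show "?f ` {1..b} \<subseteq> {1..k - 1}"
    proof
      fix i
      assume "i \<in> ?f ` {1..b}"
      then obtain j where "j \<in> {1..b}" "i = ?f j"
        by blast
      then show "i \<in> {1..k - 1}"
        using le[of j] ub[of j] by auto
    qed
  qed simp
  finally show ?thesis .
qed

lemma type_I_cross:
  fixes A :: "nat \<Rightarrow> 'p :: prime_card padic_int"
  assumes Z: "0 \<notin> zero_digits A"
    and Q: "(\<Prod>i = 1..k - 1. [:of_nat i, 1:]\<^sup>2) dvd Q"
    and v: "1 \<le> v" "v < k" "k \<le> v + m * CARD('p)"
    and dvd: "of_nat CARD('p) ^ zero_digit_count A (v + m * CARD('p) - k) dvd A (v + m * CARD('p) - k)"
  shows "of_nat CARD('p) ^ (zero_digit_count A m + 1) dvd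
    poly Q (of_nat (v + m * CARD('p) - k)) * A (v + m * CARD('p) - k)"
proof -
  let ?p = "CARD('p)"
  let ?P = "of_nat ?p :: 'p padic_int"
  define n where "n = v + m * ?p - k"
  define m' where "m' = n div ?p"
  have "n < m * ?p"
    using v by (simp add: n_def)
  then have "m' < m"
    by (simp add: m'_def less_mult_imp_div_less)
  \<comment> \<open>The number of multiples of \<open>p\<close> from \<open>n + 1\<close> to
    \<open>m p\<close>. All are values at \<open>n\<close> of factors \<open>X + i\<close> with
    \<open>i < k\<close>, since \<open>m p - n = k - v\<close> and \<open>v \<ge> 1\<close>.\<close>
  define b where "b = m - m'"
  have b: "m = m' + b" "b \<ge> 1"
    using \<open>m' < m\<close> by (auto simp: b_def)
  have n: "n = n mod ?p + m' * ?p"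
    by (simp add: m'_def)
  have "?p ^ b dvd (\<Prod>i = 1..k - 1. n + i)"
  proof (rule prime_power_dvd_prod_interval)
    show "n < Suc m' * ?p"
      by (subst n) simp
    show "(m' + b) * ?p < n + k"
      using v unfolding b(1)[symmetric] n_def by simp
  qed simp
  then obtain c where c: "(\<Prod>i = 1..k - 1. n + i) = ?p ^ b * c"
    by (metis dvdE)
  have "?P ^ b dvd of_nat (\<Prod>i = 1..k - 1. n + i)"
    unfolding c by simp
  then have "?P ^ b * ?P ^ b dvd (of_nat (\<Prod>i = 1..k - 1. n + i))\<^sup>2"
    unfolding power2_eq_square by (intro mult_dvd_mono)
  also have "(of_nat (\<Prod>i = 1..k - 1. n + i))\<^sup>2
      = poly (\<Prod>i = 1..k - 1. [:of_nat i, 1:]\<^sup>2) (of_nat n :: 'p padic_int)"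
    by (simp add: poly_prod prod_power_distrib add.commute)
  also have "\<dots> dvd poly Q (of_nat n)"
    using Q by (metis dvd_def poly_mult)
  finally have "?P ^ b * ?P ^ b * ?P ^ zero_digit_count A n dvd poly Q (of_nat n) * A n"
    using dvd unfolding n_def by (rule mult_dvd_mono)
  then have "?P ^ (b + b + zero_digit_count A n) dvd poly Q (of_nat n) * A n"
    by (simp only: power_add)
  moreover have "zero_digit_count A n \<ge> zero_digit_count A m'"
    using zero_digit_count_step[OF Z, of "n mod ?p" m'] n by simp
  \<comment> \<open>Of the \<open>2 b\<close> factors \<open>p\<close>, \<open>b\<close> make up for
    \<open>\<alpha>(m) \<le> \<alpha>(m') + b\<close>, and \<open>b \<ge> 1\<close> supplies one
    more.\<close>
  then have "zero_digit_count A m + 1 \<le> b + b + zero_digit_count A n"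
    using zero_digit_count_le_diff[OF Z, of m' b] b by simp
  ultimately show ?thesis
    unfolding n_def by (rule power_le_dvd)
qed

text \<open>At the crossing index \<open>m p - 1\<close> the factor \<open>X + 1\<close> takes the
  value \<open>m p\<close>, and the last digit \<open>p - 1\<close> compensates for the passage from
  \<open>m - 1\<close> to \<open>m\<close>.\<close>

lemma type_II_cross:
  fixes A :: "nat \<Rightarrow> 'p :: prime_card padic_int"
  assumes Z: "0 \<notin> zero_digits A" "CARD('p) - 1 \<in> zero_digits A"
    and Q: "[:1, 1:] dvd Q" and m: "m > 0"
    and dvd: "of_nat CARD('p) ^ zero_digit_count A (m * CARD('p) - 1) dvd A (m * CARD('p) - 1)"
  shows "of_nat CARD('p) ^ (zero_digit_count A m + 1) dvd
    poly Q (of_nat (m * CARD('p) - 1)) * A (m * CARD('p) - 1)"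
proof -
  let ?p = "CARD('p)"
  let ?P = "of_nat ?p :: 'p padic_int"
  define n where "n = m * ?p - 1"
  have n1: "Suc n = m * ?p"
    using m by (simp add: n_def)
  obtain m' where m': "m = Suc m'"
    using m by (cases m) auto
  have "n = (?p - 1) + m' * ?p"
    by (simp add: n_def m')
  then have "zero_digit_count A n = zero_digit_count A m' + 1"
    using zero_digit_count_step[OF Z(1), of "?p - 1" m'] Z(2) by simp
  then have le: "zero_digit_count A m + 1 \<le> 1 + zero_digit_count A n"
    using zero_digit_count_Suc_le[OF Z(1), of m'] m' by simp
  have "?P dvd of_nat (m * ?p)"
    by simp
  also have "of_nat (m * ?p) = poly [:1, 1:] (of_nat n :: 'p padic_int)"
    by (simp flip: n1)
  also have "\<dots> dvd poly Q (of_nat n)"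
    using Q by (metis dvd_def poly_mult)
  finally have "?P * ?P ^ zero_digit_count A n dvd poly Q (of_nat n) * A n"
    using dvd unfolding n_def by (rule mult_dvd_mono)
  then have "?P ^ (1 + zero_digit_count A n) dvd poly Q (of_nat n) * A n"
    by simp
  then show ?thesis
    using le unfolding n_def by (rule power_le_dvd)
qed

section \<open>The induction\<close>

text \<open>The differential operator enters only through \<open>step\<close>, whose premise is the
  case \<open>G = 1\<close>, \<open>k = 0\<close> of the induction hypothesis. General
  \<open>G\<close> and \<open>k\<close> are carried along because the Cartier operator produces
  them.\<close>

lemma constant_term_divisibility:
  fixes \<Lambda> :: "('d :: finite, 'p :: prime_card padic_int) laurent_poly"
    and A :: "nat \<Rightarrow> 'p padic_int"
  assumes K: "convex K" "{m. lattice_point m \<in> interior K} = {0}" and \<Lambda>: "supported K 1 \<Lambda>"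
    and A: "\<And>n. A n = constant_term_seq \<Lambda> n"
    and Z: "0 \<notin> zero_digits A"
    and step: "\<And>v m. \<lbrakk>1 \<le> v; v < CARD('p);
        \<And>n. n < v + m * CARD('p) \<Longrightarrow> of_nat CARD('p) ^ zero_digit_count A n dvd A n\<rbrakk> \<Longrightarrow>
      of_nat CARD('p) ^ (zero_digit_count A m + 1) dvd A (v + m * CARD('p)) - A v * A (m * CARD('p))"
    and "k \<le> n" "supported K t G" "0 \<le> t" "t < real k + 1"
  shows "of_nat CARD('p) ^ (zero_digit_count A n - k) dvd Poly_Mapping.lookup (G * \<Lambda> ^ (n - k)) 0"
  using assms(7-)
proof (induction n arbitrary: k t G rule: less_induct)
  case (less n)
  let ?p = "CARD('p)"
  let ?P = "of_nat ?p :: 'p padic_int"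
  have K0: "0 \<in> K"
    using K(2) interior_subset lattice_point_0 by (metis mem_Collect_eq singletonI subsetD)
  have one: "supported K 0 (1 :: ('d, 'p padic_int) laurent_poly)"
    by (rule supported_one[OF K0])
  have A_lookup: "A i = Poly_Mapping.lookup (1 * \<Lambda> ^ i) 0" for i
    by (simp add: A constant_term_seq_def)
  have p1: "?p > 1"
    using prime_gt_1_nat[OF prime_card[where 'a = 'p]] .
  define v m where "v = n mod ?p" and "m = n div ?p"
  have n: "n = v + m * ?p" and v: "v < ?p"
    by (simp_all add: v_def m_def)
  have count: "zero_digit_count A n = zero_digit_count A m + of_bool (v \<in> zero_digits A)"
    unfolding n by (rule zero_digit_count_step[OF Z v])
  show ?case
  \<comment> \<open>Only for \<open>k = 0\<close> and \<open>v > 0\<close> can the reduction to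
    \<open>m\<close> fall short: it would lack the factor \<open>p\<close> owed to a zero digit
    \<open>v\<close>.\<close>
  proof (cases "k = 0 \<and> v > 0")
    case True
    have IH: "?P ^ zero_digit_count A i dvd A i" if "i < n" for i
      using less.IH[OF that _ one, of 0] unfolding A_lookup[symmetric] by simp
    have "?P ^ (zero_digit_count A m + 1) dvd A n - A v * A (m * ?p)"
      unfolding n using True v IH by (intro step) (auto simp: n)
    then have "?P ^ zero_digit_count A n dvd A n - A v * A (m * ?p)"
      by (rule power_le_dvd) (simp add: count)
    moreover have "?P ^ zero_digit_count A n dvd A v * A (m * ?p)"
    proof -
      have "?P ^ zero_digit_count A (m * ?p) dvd A (m * ?p)"
        using True n by (intro IH) simp
      then have "?P ^ zero_digit_count A m dvd A (m * ?p)"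
        using zero_digit_count_step[OF Z, of 0 m] Z by simp
      moreover have "?P ^ of_bool (v \<in> zero_digits A) dvd A v"
        by (auto simp: zero_digits_def)
      ultimately show ?thesis
        unfolding count power_add by (subst mult.commute) (rule mult_dvd_mono)
    qed
    ultimately have "?P ^ zero_digit_count A n dvd A n - A v * A (m * ?p) + A v * A (m * ?p)"
      by (rule dvd_add)
    then have dvd: "?P ^ zero_digit_count A n dvd A n"
      by simp
    have G: "G = Poly_Mapping.single 0 (Poly_Mapping.lookup G 0)"
    proof (rule supported_interior_imp_constant[OF K less.prems(3) _ less.prems(2)])
      show "t < 1"
        using less.prems(4) True by simp
    qed
    have "Poly_Mapping.lookup (G * \<Lambda> ^ n) 0
        = Poly_Mapping.lookup (Poly_Mapping.single 0 (Poly_Mapping.lookup G 0) * \<Lambda> ^ n) 0"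
      by (rule arg_cong[OF G, of "\<lambda>H. Poly_Mapping.lookup (H * \<Lambda> ^ n) 0"])
    also have "\<dots> = A n * Poly_Mapping.lookup G 0"
      unfolding mult.commute[of _ "\<Lambda> ^ n"] lookup_mult_single by (simp add: A_lookup)
    finally show ?thesis
      using True dvd by simp
  next
    case False
    show ?thesis
    proof (cases "n = 0")
      case True
      then show ?thesis
        using count Z v_def m_def
        by (simp add: zero_digit_count_def digit_positions_less)
    next
      case n0: False
      then have "m < n"
        using p1 by (simp add: m_def)
      \<comment> \<open>For \<open>v > 0\<close> borrowing \<open>k - 1\<close> leaves one power to
        cover a zero digit \<open>v\<close>; for \<open>v = 0\<close> borrowing \<open>k\<close> is
        affordable, as \<open>0\<close> is not a zero digit. The cap \<open>m\<close> still suffices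
        because \<open>k \<le> n = v + m p\<close>.\<close>
      define b where "b = min m (if v > 0 then k - 1 else k)"
      have "k \<le> v + k' * ?p" if "k' = (if v > 0 then k - 1 else k)" for k'
      proof -
        have "k' \<le> k' * ?p"
          by simp
        moreover have "k \<le> v + k'"
          using that by (auto split: if_splits)
        ultimately show ?thesis
          by linarith
      qed
      then have "k \<le> v + b * ?p"
        using less.prems(1) n by (auto simp: b_def min_def)
      then have "?P ^ (zero_digit_count A m - b) dvd Poly_Mapping.lookup (G * \<Lambda> ^ (n - k)) 0"
        unfolding n using less.prems v less.IH[OF \<open>m < n\<close>]
        by (intro dwork_step[OF K(1) K0 \<Lambda>]) (auto simp: b_def)
      moreover have "zero_digit_count A n - k \<le> zero_digit_count A m - b"
        using False Z by (cases "v = 0") (auto simp: count b_def)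
      ultimately show ?thesis
        by (rule power_le_dvd)
    qed
  qed
qed

theorem theorem2:
  fixes \<Lambda> :: "('d :: finite, 'p :: prime_card padic_int) laurent_poly"
    and A :: "nat \<Rightarrow> 'p padic_int"
    and L :: "'p padic_int fps \<Rightarrow> 'p padic_int fps"
  assumes "{m. lattice_point m \<in> interior (newton_polyhedron \<Lambda>)} = {0}"
    and "\<And>n. A n = constant_term_seq \<Lambda> n"
    and "L \<in> diff_operators"
    and "L (Abs_fps A) = 0"
    and "type_I L \<or> (type_II L \<and> CARD('p) - 1 \<in> zero_digits A)"
  shows "\<forall>n. of_nat CARD('p) ^ zero_digit_count A n dvd A n"
proof
  fix n
  let ?p = "CARD('p)"
  let ?P = "of_nat ?p :: 'p padic_int"
  have p1: "?p > 1"
    using prime_gt_1_nat[OF prime_card[where 'a = 'p]] .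
  have A0: "A 0 = 1"
    by (simp add: assms(2) constant_term_seq_def)
  have Z: "0 \<notin> zero_digits A"
    using p1 by (simp add: zero_digits_def A0 padic_int_p_dvd_iff padic_rep_eqs)
  define K where "K = newton_polyhedron \<Lambda>"
  have K: "convex K" "{m. lattice_point m \<in> interior K} = {0}"
    using assms(1) by (simp_all add: K_def newton_polyhedron_def)
  have \<Lambda>: "supported K 1 \<Lambda>"
    by (auto simp: supported_def K_def newton_polyhedron_def intro: hull_inc)
  have K0: "0 \<in> K"
    using K(2) interior_subset lattice_point_0 by (metis mem_Collect_eq singletonI subsetD)
  \<comment> \<open>The bound on crossing terms is put into a form common to both types.\<close>
  obtain q Q where L: "L = diff_op q Q" and units: "preserves_units (Q 0)"
    and cross: "\<And>v m k. \<lbrakk>1 \<le> v; v < k; k \<le> q; k \<le> v + m * ?p;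
      ?P ^ zero_digit_count A (v + m * ?p - k) dvd A (v + m * ?p - k)\<rbrakk> \<Longrightarrow>
      ?P ^ (zero_digit_count A m + 1) dvd poly (Q k) (of_nat (v + m * ?p - k)) * A (v + m * ?p - k)"
  proof (cases "type_I L")
    case True
    then obtain q Q where "L = diff_op q Q" "preserves_units (Q 0)"
      "\<forall>k\<in>{2..q}. (\<Prod>i=1..k - 1. [:of_nat i, 1:]\<^sup>2) dvd Q k"
      unfolding type_I_def by blast
    \<comment> \<open>From \<open>1 \<le> v < k\<close> follows \<open>k \<ge> 2\<close>, the range
      where the squares divide \<open>Q k\<close>.\<close>
    then show ?thesis
      using type_I_cross[OF Z] by (intro that[of q Q]) auto
  next
    case False
    then have II: "type_II L" "?p - 1 \<in> zero_digits A"
      using assms(5) by auto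
    then obtain Q where Q: "L = diff_op 2 Q" "preserves_units (Q 0)" "[:1, 1:] dvd Q 2"
      unfolding type_II_def by blast
    show ?thesis
    proof (rule that[OF Q(1,2)])
      fix v m k
      assume *: "1 \<le> v" "v < k" "k \<le> 2" "k \<le> v + m * ?p"
        "?P ^ zero_digit_count A (v + m * ?p - k) dvd A (v + m * ?p - k)"
      \<comment> \<open>In order two only this pair crosses, and then \<open>k \<le> v + m p\<close>
        rules out \<open>m = 0\<close>.\<close>
      then have k: "k = 2" "v = 1"
        by auto
      then have "v + m * ?p - k = m * ?p - 1" "m > 0"
        using *(4) by (auto intro: ccontr)
      then show "?P ^ (zero_digit_count A m + 1) dvd
          poly (Q k) (of_nat (v + m * ?p - k)) * A (v + m * ?p - k)"
        using type_II_cross[OF Z II(2) Q(3)] * k by simp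
    qed
  qed
  have rec: "(\<Sum>k\<le>min q n. poly (Q k) (of_nat (n - k)) * A (n - k)) = 0" for n
    using arg_cong[OF assms(4)[unfolded L], of "\<lambda>f. fps_nth f n"] by (simp add: fps_nth_diff_op)
  have "?P ^ (zero_digit_count A n - 0) dvd Poly_Mapping.lookup (1 * \<Lambda> ^ (n - 0)) 0"
  proof (rule constant_term_divisibility[OF K \<Lambda> assms(2) Z _ le0 supported_one[OF K0]])
    fix v m
    assume v: "1 \<le> v" "v < ?p"
      and IH: "\<And>n. n < v + m * ?p \<Longrightarrow> ?P ^ zero_digit_count A n dvd A n"
    have "?P ^ zero_digit_count A (m * ?p) dvd A (m * ?p)"
      using v by (intro IH) simp
    then have dvd: "?P ^ zero_digit_count A m dvd A (m * ?p)"
      using zero_digit_count_step[OF Z, of 0 m] Z by simp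
    show "?P ^ (zero_digit_count A m + 1) dvd A (v + m * ?p) - A v * A (m * ?p)"
    proof (rule recurrence_congruence[OF rec A0 units dvd _ v(2)])
      fix w k
      assume w: "1 \<le> w" "w < ?p" "w < k" "k \<le> q" "k \<le> w + m * ?p"
      \<comment> \<open>\<open>w < k\<close> puts the index below \<open>m p\<close>, hence below
        \<open>v + m p\<close>, where \<open>IH\<close> applies.\<close>
      then show "?P ^ (zero_digit_count A m + 1) dvd
          poly (Q k) (of_nat (w + m * ?p - k)) * A (w + m * ?p - k)"
        using v by (intro cross IH) linarith+
    qed
  qed simp_all
  then show "?P ^ zero_digit_count A n dvd A n"
    by (simp add: assms(2) constant_term_seq_def)
qed

end
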